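(* Let $G$ be an exactly $2$-edge-connected multigraph. Then $G$ is obtained from a Robbins synthesis: there exists a sequence of graphs $G_i$, $0\le i\le l$, such that $G_0$ is a simple cycle, $G_l=G$, and for each $0\le i<l$ the graph $G_{i+1}$ is obtained from $G_i$ by a cycle addition.
   Context: All graphs are finite undirected multigraphs (parallel edges allowed) without loops. A multigraph with at least two vertices is exactly $k$-edge-connected if for every pair of distinct vertices $u,v$ the maximum number of pairwise edge-disjoint paths between $u$ and $v$ is exactly $k$ (parallel edges count as distinct edges). A simple cycle is a cycle without repeated vertices; its length is at least $2$, where a pair of parallel edges counts as a cycle of length $2$. A cycle addition to a graph $H$ is the addition of a simple cycle that has exactly one vertex in common with $H$ (all other vertices and all edges of the cycle being new). *)

theory Defs
  imports Main
begin

text \<open>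
  Multigraphs carry explicit edge names, so that parallel edges are distinct edges with the same
  set of ends. The value of \<open>ends\<close> is only relevant on \<open>edges\<close>.
\<close>

record ('v, 'e) pre_multigraph =
  verts :: "'v set"
  edges :: "'e set"
  ends :: "'e \<Rightarrow> 'v set"

text \<open>Two distinct ends for every edge: loops are excluded.\<close>

locale multigraph =
  fixes G :: "('v, 'e) pre_multigraph"
  assumes finite_verts: "finite (verts G)"
    and finite_edges: "finite (edges G)"
    and ends_subset: "e \<in> edges G \<Longrightarrow> ends G e \<subseteq> verts G"
    and card_ends: "e \<in> edges G \<Longrightarrow> card (ends G e) = 2"

text \<open>A path is given by its vertex sequence together with its edge sequence.\<close>

definition path_between ::
    "('v, 'e) pre_multigraph \<Rightarrow> 'v \<Rightarrow> 'v \<Rightarrow> 'v list \<times> 'e list \<Rightarrow> bool" where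
  "path_between G u v p \<longleftrightarrow>
    (case p of (vs, es) \<Rightarrow>
      length vs = Suc (length es) \<and> hd vs = u \<and> last vs = v \<and>
      distinct vs \<and> set vs \<subseteq> verts G \<and> set es \<subseteq> edges G \<and>
      (\<forall>i<length es. ends G (es ! i) = {vs ! i, vs ! Suc i}))"

definition edge_disjoint_paths ::
    "('v, 'e) pre_multigraph \<Rightarrow> 'v \<Rightarrow> 'v \<Rightarrow> ('v list \<times> 'e list) set \<Rightarrow> bool" where
  "edge_disjoint_paths G u v P \<longleftrightarrow>
    finite P \<and> (\<forall>p\<in>P. path_between G u v p) \<and>
    pairwise (\<lambda>p q. set (snd p) \<inter> set (snd q) = {}) P"

text \<open>
  The maximum is taken over a nonempty set (it contains the cardinality of the empty family),
  which is finite in a finite graph; see \<open>finite_card_edge_disjoint_paths\<close> below.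
\<close>

definition max_edge_disjoint_paths :: "('v, 'e) pre_multigraph \<Rightarrow> 'v \<Rightarrow> 'v \<Rightarrow> nat" where
  "max_edge_disjoint_paths G u v = Max {card P | P. edge_disjoint_paths G u v P}"

definition exactly_edge_connected :: "nat \<Rightarrow> ('v, 'e) pre_multigraph \<Rightarrow> bool" where
  "exactly_edge_connected k G \<longleftrightarrow>
    multigraph G \<and> card (verts G) \<ge> 2 \<and>
    (\<forall>u\<in>verts G. \<forall>v\<in>verts G. u \<noteq> v \<longrightarrow> max_edge_disjoint_paths G u v = k)"

text \<open>
  The graph \<open>C\<close> as a whole is a simple cycle; for length 2 it consists of two parallel edges.
\<close>

definition simple_cycle :: "('v, 'e) pre_multigraph \<Rightarrow> bool" where
  "simple_cycle C \<longleftrightarrow>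
    multigraph C \<and>
    (\<exists>vs es. length vs = length es \<and> length vs \<ge> 2 \<and> distinct vs \<and> distinct es \<and>
      verts C = set vs \<and> edges C = set es \<and>
      (\<forall>i<length es. ends C (es ! i) = {vs ! i, vs ! (Suc i mod length vs)}))"

text \<open>\<open>H'\<close> is the union of \<open>H\<close> and a simple cycle \<open>C\<close> sharing exactly one vertex with \<open>H\<close>.\<close>

definition cycle_addition ::
    "('v, 'e) pre_multigraph \<Rightarrow> ('v, 'e) pre_multigraph \<Rightarrow> bool" where
  "cycle_addition H H' \<longleftrightarrow>
    multigraph H \<and>
    (\<exists>C. simple_cycle C \<and> (\<exists>x. verts H \<inter> verts C = {x}) \<and> edges H \<inter> edges C = {} \<and>
      verts H' = verts H \<union> verts C \<and> edges H' = edges H \<union> edges C \<and>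
      (\<forall>e\<in>edges H. ends H' e = ends H e) \<and> (\<forall>e\<in>edges C. ends H' e = ends C e))"

lemma (in multigraph) finite_paths: "finite {p. path_between G u v p}"
proof -
  let ?V = "{vs. set vs \<subseteq> verts G \<and> length vs \<le> card (verts G)}"
  let ?E = "{es. set es \<subseteq> edges G \<and> length es \<le> card (verts G)}"
  have "length vs \<le> card (verts G)" if "distinct vs" "set vs \<subseteq> verts G" for vs
    using that finite_verts by (metis card_mono distinct_card)
  then have "{p. path_between G u v p} \<subseteq> ?V \<times> ?E"
    by (fastforce simp: path_between_def)
  moreover have "finite (?V \<times> ?E)"
    using finite_verts finite_edges by (intro finite_cartesian_product finite_lists_length_le)
  ultimately show ?thesis
    by (rule finite_subset)
qed

lemma (in multigraph) finite_card_edge_disjoint_paths: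
  "finite {card P | P. edge_disjoint_paths G u v P}"
proof -
  have "{card P | P. edge_disjoint_paths G u v P} \<subseteq> card ` Pow {p. path_between G u v p}"
    by (auto simp: edge_disjoint_paths_def)
  then show ?thesis
    using finite_paths by (meson finite_Pow_iff finite_imageI finite_subset)
qed

end

theory Submission
  imports Defs
begin

text \<open>
  A Robbins synthesis of \<open>G\<close> is grown greedily inside \<open>G\<close>. The invariant on the current subgraph
  \<open>H\<close> is that any two of its vertices are joined by two edge-disjoint paths of \<open>H\<close>
  (\<open>doubly_linked\<close>). Since \<open>G\<close> has no three edge-disjoint paths between distinct vertices, no path
  of \<open>G\<close> that avoids the edges of \<open>H\<close> can join two distinct vertices of \<open>H\<close>; every ear
  of \<open>H\<close> therefore closes up at the vertex where it started.

  As long as \<open>H\<close> is not \<open>G\<close>, such an ear exists (\<open>exists_cycle_ear\<close>). An edge of \<open>G\<close> outside \<open>H\<close>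
  with both ends in \<open>H\<close> would be a forbidden third path, so some vertex is missing from \<open>H\<close>, and by
  connectedness an edge \<open>e\<close> leaves \<open>H\<close>, from \<open>x\<close> to \<open>w\<close> say. As \<open>G\<close> has two edge-disjoint paths from
  \<open>w\<close> to \<open>x\<close>, one of them avoids \<open>e\<close>; it is followed from \<open>w\<close> until it first meets \<open>H\<close>, necessarily
  in \<open>x\<close>. Together with \<open>e\<close> this is a simple cycle that has exactly \<open>x\<close> in common with \<open>H\<close>, and adding
  it preserves the invariant (\<open>doubly_linked_cycle_addition\<close>).

  The one-vertex subgraph satisfies the invariant vacuously, and the first ear found from it is the
  initial cycle. Edge-disjoint paths are handled as disjoint edge sets, each of
  which connects the two given vertices; this makes concatenation trivial, and genuine paths are
  extracted only where needed (\<open>exists_path_into\<close>).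
\<close>

section \<open>Vertices linked by a set of edges\<close>

definition adjacency :: "('e \<Rightarrow> 'v set) \<Rightarrow> 'e set \<Rightarrow> ('v \<times> 'v) set" where
  "adjacency en A = {(a, b). \<exists>e\<in>A. en e = {a, b}}"

definition linked :: "('e \<Rightarrow> 'v set) \<Rightarrow> 'e set \<Rightarrow> 'v \<Rightarrow> 'v \<Rightarrow> bool" where
  "linked en A u v \<longleftrightarrow> (u, v) \<in> (adjacency en A)\<^sup>*"

definition two_linked :: "('e \<Rightarrow> 'v set) \<Rightarrow> 'e set \<Rightarrow> 'v \<Rightarrow> 'v \<Rightarrow> bool" where
  "two_linked en F u v \<longleftrightarrow>
    (\<exists>A B. A \<subseteq> F \<and> B \<subseteq> F \<and> A \<inter> B = {} \<and> linked en A u v \<and> linked en B u v)"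

lemma linked_refl: "linked en A u u"
  by (simp add: linked_def)

lemma linked_trans: "linked en A u v \<Longrightarrow> linked en A v w \<Longrightarrow> linked en A u w"
  by (simp add: linked_def)

lemma linked_sym:
  assumes "linked en A u v"
  shows "linked en A v u"
proof -
  have "sym (adjacency en A)"
    by (auto simp: adjacency_def sym_def insert_commute)
  then show ?thesis
    using assms unfolding linked_def by (meson sym_rtrancl symE)
qed

lemma linked_mono:
  assumes "linked en A u v" "A \<subseteq> B"
  shows "linked en B u v"
proof -
  have "adjacency en A \<subseteq> adjacency en B"
    using assms(2) by (auto simp: adjacency_def)
  then show ?thesis
    using assms(1) rtrancl_mono unfolding linked_def by blast
qed

lemma linked_edge: "e \<in> A \<Longrightarrow> en e = {u, v} \<Longrightarrow> linked en A u v"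
  by (auto simp: linked_def adjacency_def)

lemma linked_segment:
  assumes "i \<le> j" and "\<And>k. i \<le> k \<Longrightarrow> k < j \<Longrightarrow> en (g k) = {f k, f (Suc k)}"
  shows "linked en (g ` {i..<j}) (f i) (f j)"
  using assms
proof (induction j rule: dec_induct)
  case base
  show ?case by (rule linked_refl)
next
  case (step j)
  have "linked en (g ` {i..<Suc j}) (f i) (f j)"
    by (rule linked_mono[OF step.IH]) (use step in auto)
  moreover have "linked en (g ` {i..<Suc j}) (f j) (f (Suc j))"
    by (rule linked_edge[of "g j"]) (use step in auto)
  ultimately show ?case by (rule linked_trans)
qed

lemma linked_leaves_set:
  assumes "linked en A u v" "u \<in> S" "v \<notin> S"
  obtains e a b where "e \<in> A" "en e = {a, b}" "a \<in> S" "b \<notin> S"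
proof -
  have "v \<in> S \<or> (\<exists>e a b. e \<in> A \<and> en e = {a, b} \<and> a \<in> S \<and> b \<notin> S)"
    using assms(1) unfolding linked_def
  proof (induction rule: rtrancl_induct)
    case base
    then show ?case using assms(2) by blast
  next
    case (step y z)
    then show ?case unfolding adjacency_def by blast
  qed
  then show thesis using assms(3) that by blast
qed

lemma two_linked_sym: "two_linked en F u v \<Longrightarrow> two_linked en F v u"
  unfolding two_linked_def by (meson linked_sym)

lemma two_linked_mono: "two_linked en F u v \<Longrightarrow> F \<subseteq> F' \<Longrightarrow> two_linked en F' u v"
  unfolding two_linked_def by (meson order_trans)

lemma two_linked_refl: "two_linked en F u u"
  unfolding two_linked_def by (meson empty_subsetI inf_bot_left linked_refl)

text \<open>
  Transitivity of double linkage over a common edge set would require Menger's theorem; when the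
  two edge sets are disjoint, the links can simply be concatenated pairwise.
\<close>

lemma two_linked_concat:
  assumes "two_linked en F u x" "two_linked en F' x v" "F \<inter> F' = {}"
  shows "two_linked en (F \<union> F') u v"
proof -
  obtain A B where AB: "A \<subseteq> F" "B \<subseteq> F" "A \<inter> B = {}" "linked en A u x" "linked en B u x"
    using assms(1) unfolding two_linked_def by blast
  obtain A' B' where AB': "A' \<subseteq> F'" "B' \<subseteq> F'" "A' \<inter> B' = {}" "linked en A' x v" "linked en B' x v"
    using assms(2) unfolding two_linked_def by blast
  have "linked en (A \<union> A') u v" "linked en (B \<union> B') u v"
    using AB AB' by (meson linked_mono linked_trans sup_ge1 sup_ge2)+
  moreover have "A \<union> A' \<subseteq> F \<union> F'" "B \<union> B' \<subseteq> F \<union> F'" "(A \<union> A') \<inter> (B \<union> B') = {}"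
    using AB AB' assms(3) by blast+
  ultimately show ?thesis
    unfolding two_linked_def by blast
qed

text \<open>The two arcs of a cycle between two of its vertices are edge-disjoint.\<close>

lemma two_linked_simple_cycle:
  assumes "simple_cycle C" "u \<in> verts C" "v \<in> verts C"
  shows "two_linked (ends C) (edges C) u v"
proof -
  obtain vs es where len: "length vs = length es" "length vs \<ge> 2"
    and dist: "distinct es"
    and sets: "verts C = set vs" "edges C = set es"
    and inc: "\<And>i. i < length es \<Longrightarrow> ends C (es ! i) = {vs ! i, vs ! (Suc i mod length vs)}"
    using assms(1) unfolding simple_cycle_def by auto
  let ?n = "length es"
  define f where "f k = vs ! (k mod ?n)" for k
  have arc: "linked (ends C) ((!) es ` {i..<j}) (f i) (f j)" if "i \<le> j" "j \<le> ?n" for i j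
    by (rule linked_segment) (use that inc len in \<open>auto simp: f_def\<close>)
  have ordered: "two_linked (ends C) (edges C) (f i) (f j)" if ij: "i < j" "j < ?n" for i j
    unfolding two_linked_def
  proof (intro exI conjI)
    \<comment> \<open>The second arc runs from \<open>j\<close> up to the index \<open>n\<close>, which is \<open>0\<close> again, and on to \<open>i\<close>.\<close>
    let ?A = "(!) es ` {i..<j}" and ?B = "(!) es ` ({j..<?n} \<union> {0..<i})"
    show "?A \<subseteq> edges C" "?B \<subseteq> edges C"
      using ij sets by auto
    show "?A \<inter> ?B = {}"
      using ij dist by (auto simp: nth_eq_iff_index_eq)
    show "linked (ends C) ?A (f i) (f j)"
      using arc ij by simp
    have "linked (ends C) ?B (f j) (f ?n)"
      by (rule linked_mono[OF arc]) (use ij in auto)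
    moreover have "linked (ends C) ?B (f 0) (f i)"
      by (rule linked_mono[OF arc]) (use ij in auto)
    moreover have "f ?n = f 0"
      by (simp add: f_def)
    ultimately show "linked (ends C) ?B (f i) (f j)"
      by (metis linked_sym linked_trans)
  qed
  obtain i j where "i < ?n" "j < ?n" "u = f i" "v = f j"
    using assms(2,3) len sets unfolding f_def by (metis in_set_conv_nth mod_less)
  then show ?thesis
    using ordered two_linked_sym two_linked_refl by (metis linorder_neqE_nat)
qed

section \<open>Links and paths\<close>

lemma linked_path:
  assumes "path_between G u v (vs, es)"
  shows "linked (ends G) (set es) u v"
proof -
  have p: "length vs = Suc (length es)" "hd vs = u" "last vs = v"
    "\<And>i. i < length es \<Longrightarrow> ends G (es ! i) = {vs ! i, vs ! Suc i}"
    using assms unfolding path_between_def by auto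
  have "linked (ends G) ((!) es ` {0..<length es}) (vs ! 0) (vs ! length es)"
    by (rule linked_segment) (use p in auto)
  moreover have "(!) es ` {0..<length es} = set es"
    by (auto simp: set_conv_nth)
  moreover have "vs ! 0 = u" "vs ! length es = v"
    using p by (metis hd_conv_nth length_0_conv nat.distinct(1),
        metis diff_Suc_1 last_conv_nth length_0_conv nat.distinct(1))
  ultimately show ?thesis by simp
qed

lemma path_between_drop:
  assumes "path_between G u v (vs, es)" "i < length vs"
  shows "path_between G (vs ! i) v (drop i vs, drop i es)"
  using assms set_drop_subset[of i vs] set_drop_subset[of i es]
  unfolding path_between_def
  by (auto simp: hd_drop_conv_nth add.commute)

lemma path_between_Cons:
  assumes "path_between G w v (vs, es)" "e \<in> edges G" "ends G e = {u, w}"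
    "u \<in> verts G" "u \<notin> set vs"
  shows "path_between G u v (u # vs, e # es)"
proof -
  have "vs \<noteq> []"
    using assms(1) unfolding path_between_def by auto
  moreover from this have "vs ! 0 = w"
    using assms(1) unfolding path_between_def by (auto simp: hd_conv_nth)
  ultimately show ?thesis
    using assms unfolding path_between_def by (auto simp: nth_Cons split: nat.split)
qed

lemma distinct_path_edges:
  assumes "path_between G u v (vs, es)"
  shows "distinct es"
  unfolding distinct_conv_nth
proof (intro allI impI)
  fix i j assume ij: "i < length es" "j < length es" "i \<noteq> j"
  have vs: "length vs = Suc (length es)" "distinct vs"
    "\<And>i. i < length es \<Longrightarrow> ends G (es ! i) = {vs ! i, vs ! Suc i}"
    using assms unfolding path_between_def by auto
  show "es ! i \<noteq> es ! j"
  proof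
    assume "es ! i = es ! j"
    then have "{vs ! i, vs ! Suc i} = {vs ! j, vs ! Suc j}"
      using vs ij by metis
    then have "{i, Suc i} = {j, Suc j}"
      using vs ij by (auto simp: doubleton_eq_iff nth_eq_iff_index_eq)
    then show False
      using ij by (auto simp: doubleton_eq_iff)
  qed
qed

text \<open>
  A walk from \<open>u\<close> to \<open>v\<close> is made into a path by cutting out detours, and truncated at its first
  vertex in \<open>S\<close>. Taking \<open>S = {v}\<close> gives an ordinary path to \<open>v\<close>.
\<close>

lemma (in multigraph) exists_path_into:
  assumes "linked (ends G) A u v" "v \<in> S" "A \<subseteq> edges G" "v \<in> verts G"
  shows "\<exists>y vs es. y \<in> S \<and> path_between G u y (vs, es) \<and> set es \<subseteq> A \<and> set (butlast vs) \<inter> S = {}"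
  using assms(1) unfolding linked_def
proof (induction rule: converse_rtrancl_induct)
  case base
  have "path_between G v v ([v], [])"
    using assms(4) by (simp add: path_between_def)
  then show ?case
    using assms(2) by (intro exI[of _ v] exI[of _ "[v]"] exI[of _ "[]"]) simp
next
  case (step u w)
  obtain e where e: "e \<in> A" "ends G e = {u, w}"
    using step.hyps unfolding adjacency_def by auto
  have u: "u \<in> verts G"
    using e assms(3) ends_subset by blast
  obtain y vs es where p: "y \<in> S" "path_between G w y (vs, es)" "set es \<subseteq> A"
    "set (butlast vs) \<inter> S = {}"
    using step.IH by blast
  show ?case
  proof (cases "u \<in> S")
    case True
    have "path_between G u u ([u], [])"
      using u by (simp add: path_between_def)
    then show ?thesis
      using True by (intro exI[of _ u] exI[of _ "[u]"] exI[of _ "[]"]) simp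
  next
    case outside: False
    show ?thesis
    proof (cases "u \<in> set vs")
      case True
      then obtain i where i: "i < length vs" "vs ! i = u"
        by (metis in_set_conv_nth)
      have "path_between G u y (drop i vs, drop i es)"
        using path_between_drop[OF p(2) i(1)] i(2) by simp
      moreover have "set (butlast (drop i vs)) \<inter> S = {}"
        using p(4) set_drop_subset[of i "butlast vs"] by (auto simp: butlast_drop)
      moreover have "set (drop i es) \<subseteq> A"
        using p(3) set_drop_subset[of i es] by blast
      ultimately show ?thesis
        using p(1) by blast
    next
      case False
      have "path_between G u y (u # vs, e # es)"
        using path_between_Cons[OF p(2) _ e(2) u False] e(1) assms(3) by blast
      moreover have "set (butlast (u # vs)) \<inter> S = {}"
        using p(4) outside by auto
      moreover have "set (e # es) \<subseteq> A"
        using p(3) e(1) by simp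
      ultimately show ?thesis
        using p(1) by blast
    qed
  qed
qed

lemma (in multigraph) exists_path:
  assumes "linked (ends G) A u v" "A \<subseteq> edges G" "v \<in> verts G"
  shows "\<exists>p. path_between G u v p \<and> set (snd p) \<subseteq> A"
  using exists_path_into[OF assms(1) _ assms(2,3), of "{v}"] by fastforce

section \<open>Exact 2-edge-connectedness in terms of links\<close>

lemma exactly_2_two_linked:
  assumes "exactly_edge_connected 2 G" "u \<in> verts G" "v \<in> verts G" "u \<noteq> v"
  shows "two_linked (ends G) (edges G) u v"
proof -
  interpret multigraph G
    using assms(1) by (simp add: exactly_edge_connected_def)
  let ?M = "{card P | P. edge_disjoint_paths G u v P}"
  have "edge_disjoint_paths G u v {}"
    by (simp add: edge_disjoint_paths_def)
  then have "Max ?M \<in> ?M"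
    using Max_in[OF finite_card_edge_disjoint_paths] by blast
  moreover have "Max ?M = 2"
    using assms by (simp add: exactly_edge_connected_def max_edge_disjoint_paths_def)
  ultimately obtain P where P: "edge_disjoint_paths G u v P" "card P = 2"
    by auto
  then obtain p q where pq: "P = {p, q}" "p \<noteq> q"
    by (auto simp: card_2_iff)
  have paths: "path_between G u v (fst p, snd p)" "path_between G u v (fst q, snd q)"
    and disj: "set (snd p) \<inter> set (snd q) = {}"
    using P(1) pq by (auto simp: edge_disjoint_paths_def pairwise_def)
  moreover have "set (snd p) \<subseteq> edges G" "set (snd q) \<subseteq> edges G"
    using paths by (auto simp: path_between_def)
  ultimately show ?thesis
    unfolding two_linked_def using linked_path by metis
qed

lemma exactly_2_no_third_link:
  assumes "exactly_edge_connected 2 G" "u \<in> verts G" "v \<in> verts G" "u \<noteq> v"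
    and "two_linked (ends G) F u v" "linked (ends G) D u v"
    and "F \<subseteq> edges G" "D \<subseteq> edges G" "F \<inter> D = {}"
  shows False
proof -
  interpret multigraph G
    using assms(1) by (simp add: exactly_edge_connected_def)
  obtain A B where AB: "A \<subseteq> F" "B \<subseteq> F" "A \<inter> B = {}"
    "linked (ends G) A u v" "linked (ends G) B u v"
    using assms(5) unfolding two_linked_def by blast
  have "A \<subseteq> edges G" "B \<subseteq> edges G"
    using AB assms(7) by blast+
  then obtain p q r where
    p: "path_between G u v p" "set (snd p) \<subseteq> A" and
    q: "path_between G u v q" "set (snd q) \<subseteq> B" and
    r: "path_between G u v r" "set (snd r) \<subseteq> D"
    using exists_path AB(4,5) assms(3,6,8) by metis
  have disj: "set (snd p) \<inter> set (snd q) = {}" "set (snd p) \<inter> set (snd r) = {}"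
    "set (snd q) \<inter> set (snd r) = {}"
    using p q r AB assms(9) by blast+
  \<comment> \<open>Disjoint edge sets force the paths to be distinct, and the family to have three members, only
    because a path between distinct vertices has an edge.\<close>
  have nonempty: "set (snd s) \<noteq> {}" if s: "path_between G u v s" for s
  proof
    assume "set (snd s) = {}"
    then have "linked (ends G) {} u v"
      using linked_path[of G u v "fst s" "snd s"] s by (metis prod.collapse)
    then show False
      using assms(4) by (simp add: linked_def adjacency_def)
  qed
  have "p \<noteq> q" "p \<noteq> r" "q \<noteq> r"
    using disj nonempty p(1) q(1) r(1) by (metis inf.idem)+
  then have "card {p, q, r} = 3"
    by simp
  moreover have "edge_disjoint_paths G u v {p, q, r}"
    using p q r disj by (auto simp: edge_disjoint_paths_def pairwise_def Int_commute)
  ultimately have "3 \<in> {card P | P. edge_disjoint_paths G u v P}"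
    by force
  then have "3 \<le> max_edge_disjoint_paths G u v"
    unfolding max_edge_disjoint_paths_def by (rule Max_ge[OF finite_card_edge_disjoint_paths])
  then show False
    using assms(1-4) by (simp add: exactly_edge_connected_def)
qed

section \<open>Growing a doubly linked subgraph\<close>

text \<open>
  A subgraph inherits the whole function \<open>ends G\<close>, including its values off the edges, so that a
  subgraph with all vertices and all edges equals \<open>G\<close> as a record.
\<close>

definition subgraph :: "('v, 'e) pre_multigraph \<Rightarrow> ('v, 'e) pre_multigraph \<Rightarrow> bool" where
  "subgraph H G \<longleftrightarrow>
    multigraph H \<and> verts H \<subseteq> verts G \<and> edges H \<subseteq> edges G \<and> ends H = ends G"

definition doubly_linked :: "('v, 'e) pre_multigraph \<Rightarrow> bool" where
  "doubly_linked H \<longleftrightarrow> (\<forall>u\<in>verts H. \<forall>v\<in>verts H. two_linked (ends H) (edges H) u v)"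

definition graph_union ::
    "('v, 'e) pre_multigraph \<Rightarrow> ('v, 'e) pre_multigraph \<Rightarrow> ('v, 'e) pre_multigraph" where
  "graph_union H C = \<lparr>verts = verts H \<union> verts C, edges = edges H \<union> edges C, ends = ends H\<rparr>"

lemma subgraph_graph_union:
  assumes "subgraph H G" "subgraph C G"
  shows "subgraph (graph_union H C) G"
  using assms unfolding subgraph_def graph_union_def multigraph_def
  by (simp, metis Un_iff le_supI1 le_supI2)

text \<open>Links between \<open>H\<close> and the cycle are concatenated at the common vertex.\<close>

lemma doubly_linked_cycle_addition:
  assumes "doubly_linked H" "simple_cycle C" "ends C = ends H"
    and x: "verts H \<inter> verts C = {x}" and disj: "edges H \<inter> edges C = {}"
  shows "doubly_linked (graph_union H C)"
proof -
  let ?L = "two_linked (ends H) (edges H \<union> edges C)"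
  have inH: "two_linked (ends H) (edges H) u v" if "u \<in> verts H" "v \<in> verts H" for u v
    using that assms(1) by (simp add: doubly_linked_def)
  have inC: "two_linked (ends H) (edges C) u v" if "u \<in> verts C" "v \<in> verts C" for u v
    using two_linked_simple_cycle[OF assms(2) that] assms(3) by simp
  have HC: "?L u v" if "u \<in> verts H" "v \<in> verts C" for u v
    by (rule two_linked_concat[OF inH inC disj, of u x v]) (use that x in auto)
  have "?L u v" if "u \<in> verts H \<union> verts C" "v \<in> verts H \<union> verts C" for u v
    using that HC[of u v] two_linked_sym[OF HC[of v u]]
      two_linked_mono[OF inH[of u v]] two_linked_mono[OF inC[of u v]] by blast
  then show ?thesis
    by (simp add: doubly_linked_def graph_union_def)
qed

text \<open>A path closed by one further edge is a simple cycle.\<close>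

lemma closed_path_simple_cycle:
  assumes "multigraph G" and path: "path_between G w x (vs, es)" and "w \<noteq> x"
    and e: "e \<in> edges G" "ends G e = {x, w}" "e \<notin> set es"
  defines "C \<equiv> \<lparr>verts = set vs, edges = insert e (set es), ends = ends G\<rparr>"
  shows "simple_cycle C" "subgraph C G"
proof -
  interpret multigraph G by fact
  have vs: "length vs = Suc (length es)" "hd vs = w" "last vs = x" "distinct vs"
    "set vs \<subseteq> verts G" "set es \<subseteq> edges G"
    and inc: "\<And>i. i < length es \<Longrightarrow> ends G (es ! i) = {vs ! i, vs ! Suc i}"
    using path unfolding path_between_def by auto
  have "vs \<noteq> []"
    using vs(1) by auto
  then have first: "vs ! 0 = w" and final: "vs ! length es = x"
    using vs(1-3) by (auto simp: hd_conv_nth last_conv_nth)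
  have "es \<noteq> []"
    using first final assms(3) by auto
  then have len: "length vs \<ge> 2"
    using vs(1) by (cases es) auto
  have inside: "ends G d \<subseteq> set vs" if "d \<in> insert e (set es)" for d
  proof (cases "d = e")
    case True
    have "x \<in> set vs" "w \<in> set vs"
      using vs(2,3) \<open>vs \<noteq> []\<close> by auto
    then show ?thesis
      using True e(2) by simp
  next
    case False
    then obtain i where "i < length es" "es ! i = d"
      using \<open>d \<in> insert e (set es)\<close> by (auto simp: in_set_conv_nth)
    then show ?thesis
      using inc[of i] vs(1) by auto
  qed
  have mult: "multigraph C"
    using inside card_ends e(1) vs(6) by unfold_locales (auto simp: C_def)
  then show "subgraph C G"
    using vs(5,6) e(1) by (simp add: subgraph_def C_def)
  have "ends C ((es @ [e]) ! i) = {vs ! i, vs ! (Suc i mod length vs)}"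
    if "i < length (es @ [e])" for i
  proof (cases "i < length es")
    case True
    then show ?thesis
      using inc vs(1) by (simp add: C_def nth_append)
  next
    case False
    then have "i = length es"
      using that by simp
    then show ?thesis
      using first final e(2) vs(1) by (simp add: C_def)
  qed
  moreover have "distinct (es @ [e])"
    using distinct_path_edges[OF path] e(3) by simp
  moreover have "length vs = length (es @ [e])" "verts C = set vs" "edges C = set (es @ [e])"
    using vs(1) by (auto simp: C_def)
  ultimately show "simple_cycle C"
    unfolding simple_cycle_def using mult len vs(4) by metis
qed

text \<open>
  If \<open>H\<close> contained all vertices of \<open>G\<close>, it would lack an edge of \<open>G\<close>, and this edge would be a third
  link between its ends. So a vertex is missing, and a link from \<open>H\<close> to it must leave \<open>H\<close>.
\<close>

lemma exists_edge_leaving: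
  assumes G: "exactly_edge_connected 2 G"
    and H: "subgraph H G" "doubly_linked H" "verts H \<noteq> {}" "H \<noteq> G"
  obtains e x w where "e \<in> edges G" "ends G e = {x, w}" "x \<in> verts H" "w \<notin> verts H"
proof -
  interpret multigraph G
    using G by (simp add: exactly_edge_connected_def)
  have "verts H \<noteq> verts G"
  proof
    assume V: "verts H = verts G"
    then have "edges H \<noteq> edges G"
      using H(1,4) by (auto simp: subgraph_def)
    then obtain d where d: "d \<in> edges G" "d \<notin> edges H"
      using H(1) by (auto simp: subgraph_def)
    obtain u v where uv: "ends G d = {u, v}" "u \<noteq> v"
      using card_ends[OF d(1)] by (auto simp: card_2_iff)
    have "u \<in> verts G" "v \<in> verts G"
      using ends_subset[OF d(1)] uv(1) by auto
    moreover have "two_linked (ends G) (edges H) u v"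
      using H(1,2) V calculation by (auto simp: doubly_linked_def subgraph_def)
    ultimately show False
      using exactly_2_no_third_link[OF G _ _ uv(2) _ linked_edge[of d "{d}"], of "edges H"] d uv(1) H(1)
      by (auto simp: subgraph_def)
  qed
  then obtain a z where az: "a \<in> verts H" "z \<in> verts G" "z \<notin> verts H"
    using H(1,3) by (auto simp: subgraph_def)
  then have "two_linked (ends G) (edges G) a z"
    using exactly_2_two_linked[OF G, of a z] H(1) by (auto simp: subgraph_def)
  then have "linked (ends G) (edges G) a z"
    unfolding two_linked_def using linked_mono by metis
  then show thesis
    using linked_leaves_set[OF _ az(1,3)] that by metis
qed

text \<open>
  An edge leaving \<open>H\<close> at \<open>x\<close> is continued to a path that returns to \<open>H\<close> for the first time at some
  \<open>y\<close>. All its edges have an end outside \<open>H\<close>, so if \<open>y\<close> were different from \<open>x\<close>, it would be a third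
  link between \<open>x\<close> and \<open>y\<close>.
\<close>

lemma exists_cycle_ear:
  assumes G: "exactly_edge_connected 2 G"
    and H: "subgraph H G" "doubly_linked H" "verts H \<noteq> {}" "H \<noteq> G"
  obtains C x where "simple_cycle C" "subgraph C G"
    "verts H \<inter> verts C = {x}" "edges H \<inter> edges C = {}"
proof -
  interpret multigraph G
    using G by (simp add: exactly_edge_connected_def)
  have subH: "verts H \<subseteq> verts G" "edges H \<subseteq> edges G" "ends H = ends G"
    and endsH: "\<And>d. d \<in> edges H \<Longrightarrow> ends G d \<subseteq> verts H"
    using H(1) multigraph.ends_subset[of H] by (auto simp: subgraph_def)
  obtain e x w where e: "e \<in> edges G" "ends G e = {x, w}" "x \<in> verts H" "w \<notin> verts H"
    using exists_edge_leaving[OF G H] .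
  have xw: "x \<in> verts G" "w \<in> verts G" "x \<noteq> w"
    using e ends_subset[OF e(1)] by auto
  obtain A where A: "A \<subseteq> edges G" "e \<notin> A" "linked (ends G) A w x"
    using exactly_2_two_linked[OF G xw(2,1)] xw(3) unfolding two_linked_def by blast
  obtain y vs es where y: "y \<in> verts H" and path: "path_between G w y (vs, es)"
    and es: "set es \<subseteq> A" and outside: "set (butlast vs) \<inter> verts H = {}"
    using exists_path_into[OF A(3) e(3) A(1) xw(1)] by blast
  have vs: "length vs = Suc (length es)" "last vs = y"
    and inc: "\<And>i. i < length es \<Longrightarrow> ends G (es ! i) = {vs ! i, vs ! Suc i}"
    using path unfolding path_between_def by auto
  have "vs = butlast vs @ [y]"
    using vs by (metis append_butlast_last_id length_0_conv nat.distinct(1))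
  then have meet: "verts H \<inter> set vs = {y}"
    using outside y by (metis Int_Un_distrib Int_commute Int_insert_right_if1 inf_bot_right
        list.set(1,2) set_append sup_bot_left)
  have "d \<notin> edges H" if "d \<in> set es" for d
  proof -
    obtain i where i: "i < length es" "es ! i = d"
      using \<open>d \<in> set es\<close> by (auto simp: in_set_conv_nth)
    then have "vs ! i \<in> set (butlast vs)"
      using vs(1) by (metis diff_Suc_1 length_butlast nth_butlast nth_mem)
    then show ?thesis
      using inc[OF i(1)] i(2) endsH[of d] outside by auto
  qed
  moreover have "e \<notin> edges H"
    using endsH[of e] e(2,4) by auto
  ultimately have new: "edges H \<inter> insert e (set es) = {}"
    by blast
  have "y = x"
  proof (rule ccontr)
    assume "y \<noteq> x"
    have "linked (ends G) (insert e (set es)) x w"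
      using linked_edge e(2) by (metis insertI1)
    moreover have "linked (ends G) (insert e (set es)) w y"
      using linked_mono[OF linked_path[OF path]] by blast
    ultimately have "linked (ends G) (insert e (set es)) x y"
      by (rule linked_trans)
    moreover have "two_linked (ends G) (edges H) x y"
      using H(2) e(3) y subH(3) by (simp add: doubly_linked_def)
    ultimately show False
      using exactly_2_no_third_link[OF G xw(1), of y "edges H"] new \<open>y \<noteq> x\<close> y subH es A(1) e(1)
      by blast
  qed
  with path have "path_between G w x (vs, es)"
    by simp
  from closed_path_simple_cycle[OF multigraph_axioms this xw(3)[symmetric] e(1,2)]
  show thesis
    using that meet new es A(2) by (metis pre_multigraph.select_convs(1,2) subsetD)
qed

section \<open>Robbins syntheses\<close>

definition robbins_synthesizable :: "('v, 'e) pre_multigraph \<Rightarrow> bool" where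
  "robbins_synthesizable G \<longleftrightarrow> (\<exists>Gs l. simple_cycle (Gs (0::nat)) \<and> Gs l = G \<and>
    (\<forall>i<l. cycle_addition (Gs i) (Gs (Suc i))))"

lemma robbins_synthesizable_cycle_addition:
  assumes "robbins_synthesizable H" "cycle_addition H H'"
  shows "robbins_synthesizable H'"
proof -
  obtain Gs l where Gs: "simple_cycle (Gs (0::nat))" "Gs l = H"
    "\<forall>i<l. cycle_addition (Gs i) (Gs (Suc i))"
    using assms(1) unfolding robbins_synthesizable_def by blast
  have "\<forall>i<Suc l. cycle_addition ((Gs(Suc l := H')) i) ((Gs(Suc l := H')) (Suc i))"
    using Gs assms(2) by (auto simp: less_Suc_eq)
  then show ?thesis
    unfolding robbins_synthesizable_def using Gs(1)
    by (intro exI[of _ "Gs(Suc l := H')"] exI[of _ "Suc l"]) auto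
qed

lemma robbins_synthesizable_extend:
  assumes G: "exactly_edge_connected 2 G"
    and "subgraph H G" "doubly_linked H" "verts H \<noteq> {}" "robbins_synthesizable H"
  shows "robbins_synthesizable G"
  using assms(2-)
proof (induction "card (edges G - edges H)" arbitrary: H rule: less_induct)
  case less
  show ?case
  proof (cases "H = G")
    case True
    then show ?thesis using less.prems by simp
  next
    case False
    obtain C x where C: "simple_cycle C" "subgraph C G"
      "verts H \<inter> verts C = {x}" "edges H \<inter> edges C = {}"
      using exists_cycle_ear[OF G less.prems(1-3) False] .
    let ?H' = "graph_union H C"
    have ends: "ends C = ends H"
      using less.prems(1) C(2) by (simp add: subgraph_def)
    have "cycle_addition H ?H'"
      unfolding cycle_addition_def graph_union_def
      using C(1,3,4) ends less.prems(1) by (auto simp: subgraph_def)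
    then have "robbins_synthesizable ?H'"
      using less.prems(4) robbins_synthesizable_cycle_addition by blast
    moreover have "edges C \<noteq> {}"
      using C(1) by (auto simp: simple_cycle_def)
    then have "edges G - edges ?H' \<subset> edges G - edges H"
      using C(2,4) by (auto simp: graph_union_def subgraph_def)
    then have "card (edges G - edges ?H') < card (edges G - edges H)"
      using G by (intro psubset_card_mono) (auto simp: exactly_edge_connected_def multigraph_def)
    moreover have "subgraph ?H' G"
      using subgraph_graph_union less.prems(1) C(2) by blast
    moreover have "doubly_linked ?H'"
      using doubly_linked_cycle_addition[OF less.prems(2) C(1) ends C(3,4)] .
    moreover have "verts ?H' \<noteq> {}"
      using less.prems(3) by (simp add: graph_union_def)
    ultimately show ?thesis
      using less.hyps by blast
  qed
qed

theorem proposition1: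
  fixes G :: "('v, 'e) pre_multigraph"
  assumes "exactly_edge_connected 2 G"
  shows "\<exists>(Gs :: nat \<Rightarrow> ('v, 'e) pre_multigraph) l.
    simple_cycle (Gs 0) \<and> Gs l = G \<and> (\<forall>i<l. cycle_addition (Gs i) (Gs (Suc i)))"
proof -
  have two: "card (verts G) \<ge> 2"
    using assms by (simp add: exactly_edge_connected_def)
  then obtain a where a: "a \<in> verts G"
    by fastforce
  define H where "H = \<lparr>verts = {a}, edges = {}, ends = ends G\<rparr>"
  have "subgraph H G"
    using a by (simp add: subgraph_def H_def multigraph_def)
  moreover have "doubly_linked H"
    by (simp add: doubly_linked_def H_def two_linked_refl)
  moreover have "verts H \<noteq> {}"
    by (simp add: H_def)
  moreover have "H \<noteq> G"
  proof
    assume "H = G"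
    then have "verts G = {a}"
      by (metis H_def pre_multigraph.select_convs(1))
    then show False
      using two by simp
  qed
  ultimately obtain C x where C: "simple_cycle C" "subgraph C G"
    using exists_cycle_ear[OF assms] by metis
  have "doubly_linked C"
    using two_linked_simple_cycle[OF C(1)] by (simp add: doubly_linked_def)
  moreover have "verts C \<noteq> {}"
    using C(1) by (auto simp: simple_cycle_def)
  moreover have "robbins_synthesizable C"
    unfolding robbins_synthesizable_def
    using C(1) by (intro exI[of _ "\<lambda>_. C"] exI[of _ 0]) simp
  ultimately show ?thesis
    using robbins_synthesizable_extend[OF assms C(2)] unfolding robbins_synthesizable_def by blast
qed

end
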